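(* Assume the Oriented Continuity Principle (OCP). Then every total function $f:((0,1]^o,\mathcal{T}_1)\to(\mathbb{R}^o,\mathcal{T}_2)$ is continuous, where $\mathcal{T}_1$ is the oriented topology on $(0,1]^o$ and $\mathcal{T}_2$ is the ordinary topology on $\mathbb{R}^o$; that is, $f^{-1}(V)\in\mathcal{T}_1$ for every $V\in\mathcal{T}_2$.
   Context: Reasoning is in constructive (intuitionistic) logic. Oriented reals: $\mathbb{R}^o$ is the set of sequences $\alpha:\mathbb{N}\to\mathbb{Q}$ for which there is $M\in\mathbb{Q}$ with $\forall n(\alpha(n)<\alpha(n+1)<M)$. For $\alpha,\beta\in\mathbb{R}^o$: $\alpha\le\beta$ iff $\forall m\exists n(\alpha(m)<\beta(n))$; $\alpha<\beta$ iff $\exists n\forall m(\alpha(m)<\beta(n))$; equality on $\mathbb{R}^o$ is $\alpha=^o\beta$ iff $\alpha\le\beta\wedge\beta\le\alpha$. Functions on (subsets of) $\mathbb{R}^o$ are required to respect the equalities, and subsets to be closed under $=^o$. For $q\in\mathbb{Q}$, $\hat q\in\mathbb{R}^o$ is $\hat q(n)=q-\frac1{n+1}$. For $\alpha\in\mathbb{R}^o$, $r\in\mathbb{Q}$, $(\alpha+r)(n)=\alpha(n)+r$. Put $(0,1]^o=\{\alpha\in\mathbb{R}^o\mid\hat0<\alpha\le\hat1\}$, $[0,1]^o=\{\alpha\in\mathbb{R}^o\mid\hat0\le\alpha\le\hat1\}$, and for $\alpha\in(0,1]^o$, $L_\alpha=\{\gamma\in(0,1]^o\mid\gamma<\alpha\}$.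 Almost natural numbers: $\mathbb{N}^\ast$ is the set of $\xi:\mathbb{N}\to\mathbb{N}$ such that for some $k$, $\forall n(\xi(n)\le\xi(n+1)\le k)$; $\xi\le\nu$ iff $\forall m\exists n(\xi(m)\le\nu(n))$; equality on $\mathbb{N}^\ast$ is $\xi=^\ast\nu$ iff $\xi\le\nu\wedge\nu\le\xi$. A set is called non-infinite if it is not infinite, where infinite means that there is a sequence of pairwise distinct elements of the set. OCP: for every total function $\Phi:(0,1]^o\to\mathbb{N}^\ast$ (with $\alpha=^o\beta$ implying $\Phi(\alpha)=^\ast\Phi(\beta)$) there exists a non-infinite subset $E\subseteq[0,1]^o$ such that $\forall\alpha,\beta\in(0,1]^o\,[(L_\alpha\cap E=L_\beta\cap E)\to\Phi(\alpha)=^\ast\Phi(\beta)]$. Oriented topology $\mathcal{T}_1$ on $(0,1]^o$: $U\subseteq(0,1]^o$ is open iff for every $\alpha\in U$ there is a non-infinite $E\subseteq[0,1]^o$ with $S_E(\alpha)\subseteq U$, where $S_E(\alpha)=\{\beta\in(0,1]^o\mid L_\alpha\cap E=L_\beta\cap E\}$. Ordinary topology $\mathcal{T}_2$ on $\mathbb{R}^o$: let $\mathbf{Q}$ (almost rational numbers) be the set of nondecreasing sequences $\zeta:\mathbb{N}\to\mathbb{Q}$ whose image is a subset of a finite set, and for $\zeta\in\mathbf{Q}$ let $\hat\zeta\in\mathbb{R}^o$ be $\hat\zeta(n)=\zeta(n)-\frac1{n+1}$. With $\mathbb{Q}^+=\{q\in\mathbb{Q}\mid q>0\}$, define $\mathbf{d}\subseteq\mathbb{R}^o\times\mathbb{R}^o\times\mathbb{Q}^+$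 by: $\mathbf{d}(\alpha,\beta,q)$ iff there exist $\zeta\in\mathbf{Q}$ and $p\in\mathbb{Q}^+$ with $p\le q$, $\hat\zeta\le\alpha\le\hat\zeta+p$ and $\hat\zeta\le\beta\le\hat\zeta+p$. A set $V\subseteq\mathbb{R}^o$ is in $\mathcal{T}_2$ iff $\forall x\in V\,\exists p\in\mathbb{Q}^+\,\{y\in\mathbb{R}^o\mid\mathbf{d}(x,y,p)\}\subseteq V$. *)

theory Defs
  imports Complex_Main
begin

text \<open>
  The Oriented Continuity Principle contradicts the law of excluded middle: with two truth values
  it fails for the characteristic function of the sequences with rational supremum. As an ordinary
  HOL hypothesis it would therefore make everything that follows from it vacuous. So the
  constructive mathematics is read here in intuitionistic higher-order logic, interpreted with
  truth values in an arbitrary complete Heyting algebra (frame). The instance \<^typ>\<open>bool\<close> of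
  the class below is the classical reading.
\<close>

section \<open>Intuitionistic higher-order logic\<close>

class heyting_frame = complete_lattice +
  assumes inf_Sup_le: "inf a (Sup B) \<le> (SUP b\<in>B. inf a b)"

instance bool :: heyting_frame
  by standard auto

definition himp :: "'h::heyting_frame \<Rightarrow> 'h \<Rightarrow> 'h"  (infixr "\<^bold>\<longrightarrow>" 25)
  where "(a \<^bold>\<longrightarrow> b) = Sup {c. inf c a \<le> b}"

lemma le_himp_iff: "c \<le> (a \<^bold>\<longrightarrow> b) \<longleftrightarrow> inf c a \<le> (b :: 'h::heyting_frame)"
proof
  assume "c \<le> (a \<^bold>\<longrightarrow> b)"
  then have "inf c a \<le> inf a (Sup {c. inf c a \<le> b})"
    by (simp add: himp_def le_infI1)
  also have "\<dots> \<le> (SUP d\<in>{c. inf c a \<le> b}. inf a d)"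
    by (rule inf_Sup_le)
  also have "\<dots> \<le> b"
    by (auto intro!: SUP_least simp: inf_commute)
  finally show "inf c a \<le> b" .
next
  assume "inf c a \<le> b"
  then show "c \<le> (a \<^bold>\<longrightarrow> b)"
    by (auto simp: himp_def intro: Sup_upper)
qed

lemma himp_bool: "((a :: bool) \<^bold>\<longrightarrow> b) = (a \<longrightarrow> b)"
  by (auto simp: himp_def)

abbreviation hconj :: "'h::heyting_frame \<Rightarrow> 'h \<Rightarrow> 'h"  (infixr "\<^bold>\<and>" 35)
  where "a \<^bold>\<and> b \<equiv> inf a b"

abbreviation hnot :: "'h::heyting_frame \<Rightarrow> 'h"  ("\<^bold>\<not> _" [40] 40)
  where "\<^bold>\<not> a \<equiv> a \<^bold>\<longrightarrow> bot"

abbreviation hiff :: "'h::heyting_frame \<Rightarrow> 'h \<Rightarrow> 'h"  (infixr "\<^bold>\<longleftrightarrow>" 25)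
  where "a \<^bold>\<longleftrightarrow> b \<equiv> (a \<^bold>\<longrightarrow> b) \<^bold>\<and> (b \<^bold>\<longrightarrow> a)"

abbreviation hall :: "('x \<Rightarrow> 'h::heyting_frame) \<Rightarrow> 'h"  (binder "\<^bold>\<forall>" 10)
  where "\<^bold>\<forall>x. P x \<equiv> (INF x. P x)"

abbreviation hex :: "('x \<Rightarrow> 'h::heyting_frame) \<Rightarrow> 'h"  (binder "\<^bold>\<exists>" 10)
  where "\<^bold>\<exists>x. P x \<equiv> (SUP x. P x)"

text \<open>Truth value of a decidable statement about standard numbers.\<close>

definition tv :: "bool \<Rightarrow> 'h::heyting_frame"
  where "tv b = (if b then top else bot)"

definition valid :: "'h::heyting_frame \<Rightarrow> bool"
  where "valid a \<longleftrightarrow> a = top"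

text \<open>
  Internal natural and rational numbers are the standard ones, with decidable equality and order,
  so quantifiers over them range over \<^typ>\<open>nat\<close> and \<^typ>\<open>rat\<close>.  An internal sequence of numbers,
  however, need not have standard values: as an internal function it is given by its graph,
  where \<open>a n x\<close> is the truth value of ``the \<open>n\<close>th term is \<open>x\<close>'', subject to being total and
  single-valued (\<open>is_seq\<close>).  A term \<open>a n\<close> is thus of type \<open>'x \<Rightarrow> 'h\<close>; \<open>std\<close> embeds the
  standard numbers, and \<open>rel\<close> and \<open>lift\<close> extend relations and operations to such terms.

  Internal sets of sequences are functions \<open>E\<close> with \<open>E \<alpha>\<close> the truth value of
  ``\<open>\<alpha>\<close> is in \<open>E\<close>''.
\<close>

type_synonym ('x, 'h) iseq = "nat \<Rightarrow> 'x \<Rightarrow> 'h"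

definition std :: "'x \<Rightarrow> 'x \<Rightarrow> 'h::heyting_frame"
  where "std q = (\<lambda>x. tv (x = q))"

definition rel :: "('x \<Rightarrow> 'y \<Rightarrow> bool) \<Rightarrow> ('x \<Rightarrow> 'h::heyting_frame) \<Rightarrow> ('y \<Rightarrow> 'h) \<Rightarrow> 'h"
  where "rel R s t = (\<^bold>\<exists>x. \<^bold>\<exists>y. s x \<^bold>\<and> t y \<^bold>\<and> tv (R x y))"

definition lift :: "('x \<Rightarrow> 'y) \<Rightarrow> ('x \<Rightarrow> 'h::heyting_frame) \<Rightarrow> 'y \<Rightarrow> 'h"
  where "lift g s = (\<lambda>y. \<^bold>\<exists>x. s x \<^bold>\<and> tv (y = g x))"

definition is_seq :: "('x, 'h::heyting_frame) iseq \<Rightarrow> 'h"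
  where "is_seq a = (\<^bold>\<forall>n. (\<^bold>\<exists>x. a n x) \<^bold>\<and> (\<^bold>\<forall>x. \<^bold>\<forall>y. a n x \<^bold>\<and> a n y \<^bold>\<longrightarrow> tv (x = y)))"

definition seq_eq :: "('x, 'h::heyting_frame) iseq \<Rightarrow> ('x, 'h) iseq \<Rightarrow> 'h"
  where "seq_eq a b = (\<^bold>\<forall>n. rel (=) (a n) (b n))"


section \<open>Oriented reals and almost natural numbers\<close>

type_synonym 'h oseq = "(rat, 'h) iseq"

definition Ro :: "'h::heyting_frame oseq \<Rightarrow> 'h"
  where "Ro \<alpha> = (is_seq \<alpha> \<^bold>\<and>
    (\<^bold>\<exists>M. \<^bold>\<forall>n. rel (<) (\<alpha> n) (\<alpha> (Suc n)) \<^bold>\<and> rel (<) (\<alpha> (Suc n)) (std M)))"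

definition ole :: "'h::heyting_frame oseq \<Rightarrow> 'h oseq \<Rightarrow> 'h"
  where "ole \<alpha> \<beta> = (\<^bold>\<forall>m. \<^bold>\<exists>n. rel (<) (\<alpha> m) (\<beta> n))"

definition oless :: "'h::heyting_frame oseq \<Rightarrow> 'h oseq \<Rightarrow> 'h"
  where "oless \<alpha> \<beta> = (\<^bold>\<exists>n. \<^bold>\<forall>m. rel (<) (\<alpha> m) (\<beta> n))"

definition oeq :: "'h::heyting_frame oseq \<Rightarrow> 'h oseq \<Rightarrow> 'h"
  where "oeq \<alpha> \<beta> = (ole \<alpha> \<beta> \<^bold>\<and> ole \<beta> \<alpha>)"

definition ohat :: "rat \<Rightarrow> 'h::heyting_frame oseq"
  where "ohat q = (\<lambda>n. std (q - 1 / (of_nat n + 1)))"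

definition oplus :: "'h::heyting_frame oseq \<Rightarrow> rat \<Rightarrow> 'h oseq"
  where "oplus \<alpha> r = (\<lambda>n. lift (\<lambda>x. x + r) (\<alpha> n))"

definition I01 :: "'h::heyting_frame oseq \<Rightarrow> 'h"  \<comment> \<open>the half-open interval\<close>
  where "I01 \<alpha> = (Ro \<alpha> \<^bold>\<and> oless (ohat 0) \<alpha> \<^bold>\<and> ole \<alpha> (ohat 1))"

definition C01 :: "'h::heyting_frame oseq \<Rightarrow> 'h"  \<comment> \<open>the closed interval\<close>
  where "C01 \<alpha> = (Ro \<alpha> \<^bold>\<and> ole (ohat 0) \<alpha> \<^bold>\<and> ole \<alpha> (ohat 1))"

definition Lset :: "'h::heyting_frame oseq \<Rightarrow> 'h oseq \<Rightarrow> 'h"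
  where "Lset \<alpha> = (\<lambda>\<gamma>. I01 \<gamma> \<^bold>\<and> oless \<gamma> \<alpha>)"

definition Nstar :: "(nat, 'h::heyting_frame) iseq \<Rightarrow> 'h"
  where "Nstar \<xi> = (is_seq \<xi> \<^bold>\<and>
    (\<^bold>\<exists>k. \<^bold>\<forall>n. rel (\<le>) (\<xi> n) (\<xi> (Suc n)) \<^bold>\<and> rel (\<le>) (\<xi> (Suc n)) (std k)))"

definition nle :: "(nat, 'h::heyting_frame) iseq \<Rightarrow> (nat, 'h) iseq \<Rightarrow> 'h"
  where "nle \<xi> \<nu> = (\<^bold>\<forall>m. \<^bold>\<exists>n. rel (\<le>) (\<xi> m) (\<nu> n))"

definition neq :: "(nat, 'h::heyting_frame) iseq \<Rightarrow> (nat, 'h) iseq \<Rightarrow> 'h"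
  where "neq \<xi> \<nu> = (nle \<xi> \<nu> \<^bold>\<and> nle \<nu> \<xi>)"


section \<open>Subsets and functions\<close>

definition subset_of :: "('h::heyting_frame oseq \<Rightarrow> 'h) \<Rightarrow> ('h oseq \<Rightarrow> 'h) \<Rightarrow> 'h"
  where "subset_of E A = (\<^bold>\<forall>\<alpha>. E \<alpha> \<^bold>\<longrightarrow> A \<alpha>)"

text \<open>
  Subsets of the oriented reals are closed under their equality.  Since pointwise equal elements of
  \<open>Ro\<close> are in particular equal as oriented reals, such an \<open>E\<close> automatically respects the
  internal identity \<open>seq_eq\<close> of sequences.
\<close>

definition oset :: "('h::heyting_frame oseq \<Rightarrow> 'h) \<Rightarrow> 'h"
  where "oset E = (subset_of E Ro \<^bold>\<and>
    (\<^bold>\<forall>\<alpha>. \<^bold>\<forall>\<beta>. E \<alpha> \<^bold>\<and> Ro \<beta> \<^bold>\<and> oeq \<alpha> \<beta> \<^bold>\<longrightarrow> E \<beta>))"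

text \<open>
  The sequence of elements is an internal function on the natural numbers, hence a family indexed
  by \<^typ>\<open>nat\<close>.  Distinct means not equal as oriented reals.
\<close>

definition infinite_set :: "('h::heyting_frame oseq \<Rightarrow> 'h) \<Rightarrow> 'h"
  where "infinite_set E = (\<^bold>\<exists>s :: nat \<Rightarrow> 'h oseq. (\<^bold>\<forall>n. E (s n)) \<^bold>\<and>
    (\<^bold>\<forall>m. \<^bold>\<forall>n. tv (m \<noteq> n) \<^bold>\<longrightarrow> \<^bold>\<not> oeq (s m) (s n)))"

definition noninf_C01 :: "('h::heyting_frame oseq \<Rightarrow> 'h) \<Rightarrow> 'h"
  where "noninf_C01 E = (oset E \<^bold>\<and> subset_of E C01 \<^bold>\<and> \<^bold>\<not> infinite_set E)"

text \<open>
  Total functions from the set \<open>A\<close> of oriented reals to the set \<open>B\<close> of sequences with equality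
  \<open>eqB\<close>: operations on sequences that respect the given equalities.  The clause on \<open>seq_eq\<close> says
  that the HOL function \<open>f\<close> is an internal function in the first place.  Conversely every
  internal operation is of this form, since its value can be recovered from its graph \<open>G\<close> by
  \<open>f \<alpha> n x = (\<^bold>\<exists>\<beta>. G \<alpha> \<beta> \<^bold>\<and> \<beta> n x)\<close>; so quantifying over \<open>f\<close> with this guard is
  quantifying over all internal functions.
\<close>

definition total_fun :: "('h::heyting_frame oseq \<Rightarrow> 'h) \<Rightarrow> (('y, 'h) iseq \<Rightarrow> 'h) \<Rightarrow>
    (('y, 'h) iseq \<Rightarrow> ('y, 'h) iseq \<Rightarrow> 'h) \<Rightarrow> ('h oseq \<Rightarrow> ('y, 'h) iseq) \<Rightarrow> 'h"
  where "total_fun A B eqB f =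
    ((\<^bold>\<forall>\<alpha>. A \<alpha> \<^bold>\<longrightarrow> B (f \<alpha>)) \<^bold>\<and>
     (\<^bold>\<forall>\<alpha>. \<^bold>\<forall>\<beta>. A \<alpha> \<^bold>\<and> A \<beta> \<^bold>\<and> seq_eq \<alpha> \<beta> \<^bold>\<longrightarrow> seq_eq (f \<alpha>) (f \<beta>)) \<^bold>\<and>
     (\<^bold>\<forall>\<alpha>. \<^bold>\<forall>\<beta>. A \<alpha> \<^bold>\<and> A \<beta> \<^bold>\<and> oeq \<alpha> \<beta> \<^bold>\<longrightarrow> eqB (f \<alpha>) (f \<beta>)))"


section \<open>The principle and the two topologies\<close>

definition same_trace :: "('h::heyting_frame oseq \<Rightarrow> 'h) \<Rightarrow> 'h oseq \<Rightarrow> 'h oseq \<Rightarrow> 'h"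
  where "same_trace E \<alpha> \<beta> = (\<^bold>\<forall>\<gamma>. (Lset \<alpha> \<gamma> \<^bold>\<and> E \<gamma>) \<^bold>\<longleftrightarrow> (Lset \<beta> \<gamma> \<^bold>\<and> E \<gamma>))"

definition OCP :: "'h::heyting_frame"
  where "OCP = (\<^bold>\<forall>\<Phi> :: 'h oseq \<Rightarrow> (nat, 'h) iseq. total_fun I01 Nstar neq \<Phi> \<^bold>\<longrightarrow>
    (\<^bold>\<exists>E. noninf_C01 E \<^bold>\<and>
      (\<^bold>\<forall>\<alpha>. \<^bold>\<forall>\<beta>. I01 \<alpha> \<^bold>\<and> I01 \<beta> \<^bold>\<longrightarrow> same_trace E \<alpha> \<beta> \<^bold>\<longrightarrow> neq (\<Phi> \<alpha>) (\<Phi> \<beta>))))"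

definition S :: "('h::heyting_frame oseq \<Rightarrow> 'h) \<Rightarrow> 'h oseq \<Rightarrow> 'h oseq \<Rightarrow> 'h"
  where "S E \<alpha> = (\<lambda>\<beta>. I01 \<beta> \<^bold>\<and> same_trace E \<alpha> \<beta>)"

definition T1 :: "('h::heyting_frame oseq \<Rightarrow> 'h) \<Rightarrow> 'h"
  where "T1 U = (oset U \<^bold>\<and> subset_of U I01 \<^bold>\<and>
    (\<^bold>\<forall>\<alpha>. U \<alpha> \<^bold>\<longrightarrow> (\<^bold>\<exists>E. noninf_C01 E \<^bold>\<and> subset_of (S E \<alpha>) U)))"

text \<open>
  Almost rational numbers.  A finite set of rationals is one that can be listed, so it is
  given by a standard finite set.
\<close>

definition Qbold :: "'h::heyting_frame oseq \<Rightarrow> 'h"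
  where "Qbold \<zeta> = (is_seq \<zeta> \<^bold>\<and> (\<^bold>\<forall>n. rel (\<le>) (\<zeta> n) (\<zeta> (Suc n))) \<^bold>\<and>
    (\<^bold>\<exists>F. tv (finite F) \<^bold>\<and> (\<^bold>\<forall>n. \<^bold>\<exists>x. tv (x \<in> F) \<^bold>\<and> \<zeta> n x)))"

definition zhat :: "'h::heyting_frame oseq \<Rightarrow> 'h oseq"
  where "zhat \<zeta> = (\<lambda>n. lift (\<lambda>x. x - 1 / (of_nat n + 1)) (\<zeta> n))"

definition dd :: "'h::heyting_frame oseq \<Rightarrow> 'h oseq \<Rightarrow> rat \<Rightarrow> 'h"
  where "dd \<alpha> \<beta> q = (\<^bold>\<exists>\<zeta>. \<^bold>\<exists>p. Qbold \<zeta> \<^bold>\<and> tv (0 < p \<and> p \<le> q) \<^bold>\<and>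
    ole (zhat \<zeta>) \<alpha> \<^bold>\<and> ole \<alpha> (oplus (zhat \<zeta>) p) \<^bold>\<and>
    ole (zhat \<zeta>) \<beta> \<^bold>\<and> ole \<beta> (oplus (zhat \<zeta>) p))"

definition T2 :: "('h::heyting_frame oseq \<Rightarrow> 'h) \<Rightarrow> 'h"
  where "T2 V = (oset V \<^bold>\<and>
    (\<^bold>\<forall>x. V x \<^bold>\<longrightarrow> (\<^bold>\<exists>p. tv (0 < p) \<^bold>\<and> subset_of (\<lambda>y. Ro y \<^bold>\<and> dd x y p) V)))"

definition preimage :: "('h::heyting_frame oseq \<Rightarrow> 'h oseq) \<Rightarrow> ('h oseq \<Rightarrow> 'h) \<Rightarrow> 'h oseq \<Rightarrow> 'h"
  where "preimage f V = (\<lambda>\<alpha>. I01 \<alpha> \<^bold>\<and> V (f \<alpha>))"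

definition continuous_T1_T2 :: "('h::heyting_frame oseq \<Rightarrow> 'h oseq) \<Rightarrow> 'h"
  where "continuous_T1_T2 f = (\<^bold>\<forall>V. T2 V \<^bold>\<longrightarrow> T1 (preimage f V))"

end

theory Submission
  imports Defs
begin

text \<open>
  Let \<open>f \<alpha> \<in> V\<close> and let \<open>p\<close> be a radius for \<open>f \<alpha>\<close> in \<open>V\<close>. Cut the line into cells
  \<open>(c + (k - 1) p, c + k p]\<close>, where \<open>c + p\<close> is the first term of \<open>f \<alpha>\<close>, and let \<open>\<Phi> \<beta> n\<close> be the
  number of the cell of the \<open>n\<close>th term of \<open>f \<beta>\<close>, all terms below \<open>c\<close> being put into cell \<open>0\<close>.
  This respects the equalities because the cell number is monotone, so OCP gives a set \<open>E\<close> such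
  that \<open>\<Phi> \<beta> = \<Phi> \<alpha>\<close> for all \<open>\<beta> \<in> S E \<alpha>\<close>. Then the left endpoints of the cells of \<open>f \<alpha>\<close> form an
  almost rational number witnessing that \<open>f \<alpha>\<close> and \<open>f \<beta>\<close> have distance at most \<open>p\<close>.

  The argument is carried out in forcing style: \<open>h \<le> \<phi>\<close> says that \<open>\<phi>\<close> holds at stage \<open>h\<close>, this
  persists to stages \<open>k \<le> h\<close>, and eliminating an existential quantifier passes to smaller stages.
\<close>

section \<open>Forcing\<close>

lemma le_himpI:
  assumes "\<And>k. k \<le> h \<Longrightarrow> k \<le> a \<Longrightarrow> k \<le> b"
  shows "h \<le> (a \<^bold>\<longrightarrow> b)"
  by (simp add: le_himp_iff assms)

lemma le_himpD:
  assumes "h \<le> (a \<^bold>\<longrightarrow> b)" "h \<le> a"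
  shows "h \<le> b"
  using assms by (simp add: le_himp_iff inf_absorb1)

lemma le_allI: "(\<And>x. h \<le> P x) \<Longrightarrow> h \<le> (\<^bold>\<forall>x. P x)"
  by (rule INF_greatest)

lemma le_allD: "h \<le> (\<^bold>\<forall>x. P x) \<Longrightarrow> h \<le> P x"
  by (rule order_trans[OF _ INF_lower[OF UNIV_I]])

lemma le_exI: "h \<le> P x \<Longrightarrow> h \<le> (\<^bold>\<exists>x. P x)"
  by (rule order_trans[OF _ SUP_upper[OF UNIV_I]])

text \<open>By the frame law \<open>h\<close> is the supremum of the stages
  \<open>inf h (P x)\<close>, so \<open>G\<close> need only be checked at these, one witness at a
  time. Different parts of \<open>h\<close> may have different witnesses.\<close>

lemma le_exE:
  assumes "h \<le> (\<^bold>\<exists>x. P x)"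
    and step: "\<And>k x. k \<le> h \<Longrightarrow> k \<le> P x \<Longrightarrow> k \<le> G"
  shows "h \<le> G"
proof -
  have "h \<le> inf h (\<^bold>\<exists>x. P x)"
    using assms(1) by simp
  also have "\<dots> \<le> (SUP b\<in>range P. inf h b)"
    by (rule inf_Sup_le)
  also have "\<dots> \<le> G"
    by (auto intro!: SUP_least step[OF inf_le1 inf_le2])
  finally show ?thesis .
qed

section \<open>Standard statements and terms\<close>

lemma le_tvI: "b \<Longrightarrow> h \<le> tv b"
  by (simp add: tv_def)

text \<open>A standard statement is outright true or false, and in the false case \<open>h\<close>
  is \<open>bot\<close>, which forces everything. So \<open>b\<close> may be assumed in the
  metalogic.\<close>

lemma le_tvE:
  assumes "h \<le> tv b" "b \<Longrightarrow> h \<le> G"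
  shows "h \<le> G"
  using assms by (cases b) (auto simp: tv_def intro: order_trans)

lemma le_stdI: "h \<le> std q q"
  by (simp add: std_def tv_def)

lemma le_relI: "h \<le> s x \<Longrightarrow> h \<le> t y \<Longrightarrow> R x y \<Longrightarrow> h \<le> rel R s t"
  unfolding rel_def by (rule le_exI[where x = x], rule le_exI[where x = y]) (simp add: le_tvI)

text \<open>An internal term has standard values only locally. Passing to stages where both values
  are fixed turns a statement about terms into an ordinary one about numbers.\<close>

lemma le_relE:
  assumes "h \<le> rel R s t"
    and step: "\<And>k x y. k \<le> h \<Longrightarrow> k \<le> s x \<Longrightarrow> k \<le> t y \<Longrightarrow> R x y \<Longrightarrow> k \<le> G"
  shows "h \<le> G"
  using assms(1) unfolding rel_def
proof (rule le_exE)
  fix k x assume k: "k \<le> h" "k \<le> (\<^bold>\<exists>y. s x \<^bold>\<and> t y \<^bold>\<and> tv (R x y))"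
  from k(2) show "k \<le> G"
  proof (rule le_exE)
    fix l y assume l: "l \<le> k" "l \<le> (s x \<^bold>\<and> t y \<^bold>\<and> tv (R x y))"
    then have "l \<le> tv (R x y)" by simp
    then show "l \<le> G"
      by (rule le_tvE) (use k l in \<open>auto intro: step order_trans\<close>)
  qed
qed

lemma le_rel_stdE:
  assumes "h \<le> rel R s (std q)"
    and step: "\<And>k x. k \<le> h \<Longrightarrow> k \<le> s x \<Longrightarrow> R x q \<Longrightarrow> k \<le> G"
  shows "h \<le> G"
  using assms(1)
proof (rule le_relE)
  fix k x y assume k: "k \<le> h" "k \<le> s x" "k \<le> std q y" "R x y"
  from k(3) show "k \<le> G"
    unfolding std_def by (rule le_tvE) (use k in \<open>auto intro: step\<close>)
qed

lemma le_liftI: "h \<le> s x \<Longrightarrow> y = g x \<Longrightarrow> h \<le> lift g s y"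
  unfolding lift_def by (rule le_exI[where x = x]) (simp add: le_tvI)

lemma le_liftE:
  assumes "h \<le> lift g s y"
    and step: "\<And>k x. k \<le> h \<Longrightarrow> k \<le> s x \<Longrightarrow> y = g x \<Longrightarrow> k \<le> G"
  shows "h \<le> G"
  using assms(1) unfolding lift_def
proof (rule le_exE)
  fix k x assume k: "k \<le> h" "k \<le> (s x \<^bold>\<and> tv (y = g x))"
  then have "k \<le> tv (y = g x)" by simp
  then show "k \<le> G"
    by (rule le_tvE) (use k in \<open>auto intro: step\<close>)
qed

lemma le_rel_lift:
  assumes "h \<le> rel R s t" "\<And>x y. R x y \<Longrightarrow> R' (g x) (g' y)"
  shows "h \<le> rel R' (lift g s) (lift g' t)"
  using assms(1)
  by (rule le_relE) (auto intro!: le_relI le_liftI assms(2))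

section \<open>Internal sequences\<close>

lemma le_is_seq_total: "h \<le> is_seq a \<Longrightarrow> h \<le> (\<^bold>\<exists>x. a n x)"
  unfolding is_seq_def by (drule le_allD[where x = n]) simp

text \<open>The form of an elimination rule allows values occurring at the same stage to be
  identified in the metalogic; if they differ, the stage is \<open>bot\<close>.\<close>

lemma le_is_seq_unique:
  assumes "h \<le> is_seq a" "h \<le> a n x" "h \<le> a n y" "x = y \<Longrightarrow> h \<le> G"
  shows "h \<le> G"
proof -
  have "h \<le> (\<^bold>\<forall>x. \<^bold>\<forall>y. a n x \<^bold>\<and> a n y \<^bold>\<longrightarrow> tv (x = y))"
    using assms(1) unfolding is_seq_def by (simp add: le_INF_iff)
  then have "h \<le> (a n x \<^bold>\<and> a n y \<^bold>\<longrightarrow> tv (x = y))"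
    by (simp add: le_INF_iff)
  then have "h \<le> tv (x = y)"
    by (rule le_himpD) (simp add: assms)
  then show ?thesis
    by (rule le_tvE) (rule assms(4))
qed

lemma le_is_seq_lift:
  assumes a: "h \<le> is_seq a"
  shows "h \<le> is_seq (\<lambda>n. lift (g n) (a n))"
  unfolding is_seq_def
proof (intro le_allI le_infI)
  fix n
  from le_is_seq_total[OF a] show "h \<le> (\<^bold>\<exists>y. lift (g n) (a n) y)"
    by (rule le_exE) (rule le_exI, rule le_liftI, auto)
next
  fix n y y'
  show "h \<le> (lift (g n) (a n) y \<^bold>\<and> lift (g n) (a n) y' \<^bold>\<longrightarrow> tv (y = y'))"
  proof (rule le_himpI)
    fix k assume k: "k \<le> h" "k \<le> (lift (g n) (a n) y \<^bold>\<and> lift (g n) (a n) y')"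
    then have "k \<le> lift (g n) (a n) y" by simp
    then show "k \<le> tv (y = y')"
    proof (rule le_liftE)
      fix l x assume l: "l \<le> k" "l \<le> a n x" "y = g n x"
      have "l \<le> lift (g n) (a n) y'"
        using k l by (auto intro: order_trans)
      then show "l \<le> tv (y = y')"
      proof (rule le_liftE)
        fix m x' assume m: "m \<le> l" "m \<le> a n x'" "y' = g n x'"
        have "m \<le> is_seq a" "m \<le> a n x"
          using a k l m by (auto intro: order_trans)
        then show "m \<le> tv (y = y')"
          using m(2) by (rule le_is_seq_unique) (simp add: l m le_tvI)
      qed
    qed
  qed
qed

text \<open>The two hypotheses may produce different values of the middle term \<open>b n\<close>;
  single-valuedness identifies them at a smaller stage.\<close>

lemma le_rel_trans:
  assumes b: "h \<le> is_seq b" and st: "h \<le> rel R s (b n)" and tu: "h \<le> rel R' (b n) u"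
    and R: "\<And>x y z. R x y \<Longrightarrow> R' y z \<Longrightarrow> R'' x z"
  shows "h \<le> rel R'' s u"
  using st
proof (rule le_relE)
  fix k x y assume k: "k \<le> h" "k \<le> s x" "k \<le> b n y" "R x y"
  from k(1) tu have "k \<le> rel R' (b n) u" by (rule order_trans)
  then show "k \<le> rel R'' s u"
  proof (rule le_relE)
    fix l y' z assume l: "l \<le> k" "l \<le> b n y'" "l \<le> u z" "R' y' z"
    have "l \<le> is_seq b" "l \<le> b n y" "l \<le> s x"
      using b k l by (auto intro: order_trans)
    then show "l \<le> rel R'' s u"
      by (metis R k(4) l(2-4) le_is_seq_unique le_relI)
  qed
qed


section \<open>Oriented reals\<close>

lemma le_Ro_is_seq: "h \<le> Ro a \<Longrightarrow> h \<le> is_seq a"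
  by (simp add: Ro_def)

lemma le_Ro_step:
  assumes "h \<le> Ro a"
  shows "h \<le> rel (<) (a n) (a (Suc n))"
proof -
  have "h \<le> (\<^bold>\<exists>M. \<^bold>\<forall>n. rel (<) (a n) (a (Suc n)) \<^bold>\<and> rel (<) (a (Suc n)) (std M))"
    using assms by (simp add: Ro_def)
  then show ?thesis
    by (rule le_exE) (drule le_allD[where x = n], simp)
qed

lemma le_Ro_mono:
  assumes a: "h \<le> Ro a" and "n \<le> m"
  shows "h \<le> rel (\<le>) (a n) (a m)"
  using \<open>n \<le> m\<close>
proof (induction m rule: dec_induct)
  case base
  from le_is_seq_total[OF le_Ro_is_seq[OF a]] show ?case
    by (rule le_exE) (auto intro: le_relI)
next
  case (step m)
  show ?case
    by (rule le_rel_trans[OF le_Ro_is_seq[OF a] step.IH le_Ro_step[OF a]]) simp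
qed

text \<open>Monotonicity yields values \<open>x'\<close> and \<open>y'\<close> of its own.
  Single-valuedness identifies them with the given ones, so that \<open>x\<close> and
  \<open>y\<close> are compared as rationals.\<close>

lemma le_Ro_mono_values:
  assumes a: "h \<le> Ro a" and "n \<le> m" and x: "h \<le> a n x" and y: "h \<le> a m y"
    and step: "x \<le> y \<Longrightarrow> h \<le> G"
  shows "h \<le> G"
  using le_Ro_mono[OF a \<open>n \<le> m\<close>]
proof (rule le_relE)
  fix k x' y' assume k: "k \<le> h" "k \<le> a n x'" "k \<le> a m y'" "x' \<le> y'"
  have ka: "k \<le> is_seq a" "k \<le> a n x" "k \<le> a m y"
    using k(1) le_Ro_is_seq[OF a] x y by (auto intro: order_trans)
  show "k \<le> G"
  proof (rule le_is_seq_unique[OF ka(1,2) k(2)])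
    assume "x = x'"
    show "k \<le> G"
      by (rule le_is_seq_unique[OF ka(1,3) k(3)])
        (use k \<open>x = x'\<close> in \<open>auto intro: order_trans step\<close>)
  qed
qed

text \<open>\<open>Ro\<close> states the bound from index 1 on only; strict increase carries it to
  index 0.\<close>

lemma le_Ro_boundedE:
  assumes a: "h \<le> Ro a"
    and step: "\<And>k M. k \<le> h \<Longrightarrow> (\<And>n. k \<le> rel (<) (a n) (std M)) \<Longrightarrow> k \<le> G"
  shows "h \<le> G"
proof -
  have "h \<le> (\<^bold>\<exists>M. \<^bold>\<forall>n. rel (<) (a n) (a (Suc n)) \<^bold>\<and> rel (<) (a (Suc n)) (std M))"
    using a by (simp add: Ro_def)
  then show ?thesis
  proof (rule le_exE)
    fix k M
    assume k: "k \<le> h"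
      "k \<le> (\<^bold>\<forall>n. rel (<) (a n) (a (Suc n)) \<^bold>\<and> rel (<) (a (Suc n)) (std M))"
    have "k \<le> rel (<) (a n) (std M)" for n
    proof (rule le_rel_trans)
      show "k \<le> is_seq a"
        using a k(1) by (auto intro: le_Ro_is_seq order_trans)
      show "k \<le> rel (<) (a n) (a (Suc n))" "k \<le> rel (<) (a (Suc n)) (std M)"
        using le_allD[OF k(2), of n] by simp_all
    qed simp
    then show "k \<le> G"
      by (rule step[OF k(1)])
  qed
qed

lemma le_ole_trans:
  assumes b: "h \<le> is_seq b" and ab: "h \<le> ole a b" and bc: "h \<le> ole b c"
  shows "h \<le> ole a c"
  unfolding ole_def
proof (rule le_allI)
  fix m
  from ab have "h \<le> (\<^bold>\<exists>n. rel (<) (a m) (b n))"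
    unfolding ole_def by (rule le_allD)
  then show "h \<le> (\<^bold>\<exists>n. rel (<) (a m) (c n))"
  proof (rule le_exE)
    fix k n assume k: "k \<le> h" "k \<le> rel (<) (a m) (b n)"
    have "k \<le> (\<^bold>\<exists>i. rel (<) (b n) (c i))"
      using order_trans[OF k(1) bc] unfolding ole_def by (rule le_allD)
    then show "k \<le> (\<^bold>\<exists>n. rel (<) (a m) (c n))"
    proof (rule le_exE)
      fix l i assume l: "l \<le> k" "l \<le> rel (<) (b n) (c i)"
      have "l \<le> is_seq b" "l \<le> rel (<) (a m) (b n)"
        using b k l by (auto intro: order_trans)
      then have "l \<le> rel (<) (a m) (c i)"
        using l(2) by (rule le_rel_trans) simp
      then show "l \<le> (\<^bold>\<exists>n. rel (<) (a m) (c n))"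
        by (rule le_exI)
    qed
  qed
qed

lemma le_oless_ole_trans:
  assumes b: "h \<le> is_seq b" and ab: "h \<le> oless a b" and bc: "h \<le> ole b c"
  shows "h \<le> oless a c"
  using ab unfolding oless_def
proof (rule le_exE)
  fix k n assume k: "k \<le> h" "k \<le> (\<^bold>\<forall>m. rel (<) (a m) (b n))"
  have "k \<le> (\<^bold>\<exists>i. rel (<) (b n) (c i))"
    using order_trans[OF k(1) bc] unfolding ole_def by (rule le_allD)
  then show "k \<le> (\<^bold>\<exists>n. \<^bold>\<forall>m. rel (<) (a m) (c n))"
  proof (rule le_exE)
    fix l i assume l: "l \<le> k" "l \<le> rel (<) (b n) (c i)"
    have lb: "l \<le> is_seq b" "l \<le> (\<^bold>\<forall>m. rel (<) (a m) (b n))"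
      using b k l by (auto intro: order_trans)
    show "l \<le> (\<^bold>\<exists>n. \<^bold>\<forall>m. rel (<) (a m) (c n))"
      by (intro le_exI le_allI)
        (rule le_rel_trans[OF lb(1) le_allD[OF lb(2)] l(2)], simp)
  qed
qed

text \<open>Both bounds carry over by transitivity through \<open>a\<close>. This serves the closure
  of preimages under \<open>oeq\<close>.\<close>

lemma le_I01_oeq:
  assumes a: "h \<le> I01 a" and b: "h \<le> Ro b" and ab: "h \<le> oeq a b"
  shows "h \<le> I01 b"
proof -
  have "h \<le> is_seq a"
    using a by (simp add: I01_def Ro_def)
  then show ?thesis
    using assms le_oless_ole_trans[of h a "ohat 0" b] le_ole_trans[of h a b "ohat 1"]
    by (simp add: I01_def oeq_def)
qed

section \<open>Values of total functions\<close>

lemma le_total_funD: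
  assumes "h \<le> total_fun A B eqB f" "h \<le> A \<alpha>"
  shows "h \<le> B (f \<alpha>)"
proof -
  have "h \<le> (\<^bold>\<forall>\<alpha>. A \<alpha> \<^bold>\<longrightarrow> B (f \<alpha>))"
    using assms(1) by (simp add: total_fun_def)
  from le_himpD[OF le_allD[OF this] assms(2)] show ?thesis .
qed

lemma le_total_fun_cong:
  assumes "h \<le> total_fun A B eqB f" "h \<le> A \<alpha>" "h \<le> A \<beta>" "h \<le> oeq \<alpha> \<beta>"
  shows "h \<le> eqB (f \<alpha>) (f \<beta>)"
proof -
  have "h \<le> (\<^bold>\<forall>\<alpha>. \<^bold>\<forall>\<beta>. A \<alpha> \<^bold>\<and> A \<beta> \<^bold>\<and> oeq \<alpha> \<beta> \<^bold>\<longrightarrow> eqB (f \<alpha>) (f \<beta>))"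
    using assms(1) by (simp add: total_fun_def)
  from le_himpD[OF le_allD[OF le_allD[OF this]]] assms(2-4) show ?thesis
    by simp
qed


section \<open>Cells\<close>

text \<open>Truncation by \<open>nat\<close> keeps the cell number monotone and the upper bound
  \<open>le_cell\<close> valid for every \<open>x\<close>; the lower bound \<open>cell_less\<close>
  is available in positive cells only.\<close>

definition cell :: "rat \<Rightarrow> rat \<Rightarrow> rat \<Rightarrow> nat"
  where "cell c p x = nat \<lceil>(x - c) / p\<rceil>"

lemma cell_mono: "0 < p \<Longrightarrow> x \<le> y \<Longrightarrow> cell c p x \<le> cell c p y"
  unfolding cell_def by (intro nat_mono ceiling_mono divide_right_mono) auto

lemma le_cell:
  assumes "0 < p"
  shows "x \<le> c + p * of_nat (cell c p x)"
proof -
  have "(x - c) / p \<le> of_int \<lceil>(x - c) / p\<rceil>"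
    by simp
  also have "\<dots> \<le> of_int (int (cell c p x))"
    unfolding cell_def of_int_le_iff by simp
  finally show ?thesis
    using assms by (simp add: field_simps)
qed

lemma cell_less:
  assumes "0 < p" "0 < cell c p x"
  shows "c + p * (of_nat (cell c p x) - 1) < x"
proof -
  have "of_nat (cell c p x) = (of_int \<lceil>(x - c) / p\<rceil> :: rat)"
    using assms(2) unfolding cell_def by simp
  also have "\<dots> < (x - c) / p + 1"
    by linarith
  finally show ?thesis
    using assms(1) by (simp add: field_simps)
qed

lemma cell_pos: "0 < p \<Longrightarrow> c < x \<Longrightarrow> 0 < cell c p x"
  by (simp add: cell_def)

section \<open>Cell numbers as almost natural numbers\<close>

abbreviation cells :: "rat \<Rightarrow> rat \<Rightarrow> 'h::heyting_frame oseq \<Rightarrow> (nat, 'h) iseq"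
  where "cells c p a \<equiv> (\<lambda>n. lift (cell c p) (a n))"

lemma le_nle_cells:
  assumes "0 < p" "h \<le> ole a b"
  shows "h \<le> nle (cells c p a) (cells c p b)"
  unfolding nle_def
proof (rule le_allI)
  fix m
  from assms(2) have "h \<le> (\<^bold>\<exists>n. rel (<) (a m) (b n))"
    unfolding ole_def by (rule le_allD)
  then show "h \<le> (\<^bold>\<exists>n. rel (\<le>) (cells c p a m) (cells c p b n))"
    by (rule le_exE) (rule le_exI, erule le_rel_lift, simp add: cell_mono assms(1))
qed

lemma le_Nstar_cells:
  assumes p: "0 < p" and a: "h \<le> Ro a"
  shows "h \<le> Nstar (cells c p a)"
  unfolding Nstar_def
proof (rule le_infI)
  show "h \<le> is_seq (cells c p a)"
    by (intro le_is_seq_lift le_Ro_is_seq a)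
  from a show "h \<le> (\<^bold>\<exists>k. \<^bold>\<forall>n. rel (\<le>) (cells c p a n) (cells c p a (Suc n)) \<^bold>\<and>
      rel (\<le>) (cells c p a (Suc n)) (std k))"
  proof (rule le_Ro_boundedE)
    fix k M assume k: "k \<le> h" and M: "\<And>n. k \<le> rel (<) (a n) (std M)"
    have "k \<le> Ro a" using k a by (rule order_trans)
    then have "k \<le> rel (\<le>) (cells c p a n) (cells c p a (Suc n))" for n
      by (rule le_rel_lift[OF le_Ro_step]) (simp add: cell_mono p)
    moreover have "k \<le> rel (\<le>) (cells c p a (Suc n)) (std (cell c p M))" for n
      using M[of "Suc n"]
      by (rule le_rel_stdE) (auto intro!: le_relI le_liftI le_stdI cell_mono p)
    ultimately show "k \<le> (\<^bold>\<exists>k. \<^bold>\<forall>n. rel (\<le>) (cells c p a n) (cells c p a (Suc n)) \<^bold>\<and>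
        rel (\<le>) (cells c p a (Suc n)) (std k))"
      by (intro le_exI le_allI le_infI)
  qed
qed

text \<open>This turns \<open>f\<close> into a function to which OCP applies. Identity of sequences
  survives because \<open>cell\<close> is applied termwise, \<open>oeq\<close> because
  \<open>cell\<close> is monotone.\<close>

lemma le_total_fun_cells:
  assumes p: "0 < p" and f: "h \<le> total_fun A Ro oeq f"
  shows "h \<le> total_fun A Nstar neq (\<lambda>\<beta>. cells c p (f \<beta>))"
  unfolding total_fun_def
proof (intro le_infI le_allI le_himpI)
  fix k \<alpha> assume k: "k \<le> h" "k \<le> A \<alpha>"
  show "k \<le> Nstar (cells c p (f \<alpha>))"
    by (rule le_Nstar_cells[OF p le_total_funD[OF order_trans[OF k(1) f] k(2)]])
next
  fix k \<alpha> \<beta> assume k: "k \<le> h" "k \<le> (A \<alpha> \<^bold>\<and> A \<beta> \<^bold>\<and> seq_eq \<alpha> \<beta>)"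
  have "h \<le> (\<^bold>\<forall>\<alpha>. \<^bold>\<forall>\<beta>. A \<alpha> \<^bold>\<and> A \<beta> \<^bold>\<and> seq_eq \<alpha> \<beta> \<^bold>\<longrightarrow> seq_eq (f \<alpha>) (f \<beta>))"
    using f unfolding total_fun_def by simp
  then have "h \<le> (A \<alpha> \<^bold>\<and> A \<beta> \<^bold>\<and> seq_eq \<alpha> \<beta> \<^bold>\<longrightarrow> seq_eq (f \<alpha>) (f \<beta>))"
    by (simp add: le_INF_iff)
  from le_himpD[OF order_trans[OF k(1) this] k(2)] have "k \<le> seq_eq (f \<alpha>) (f \<beta>)" .
  then have "k \<le> rel (=) (f \<alpha> n) (f \<beta> n)" for n
    unfolding seq_eq_def by (rule le_allD)
  then show "k \<le> seq_eq (cells c p (f \<alpha>)) (cells c p (f \<beta>))"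
    unfolding seq_eq_def by (rule le_allI[OF le_rel_lift]) simp
next
  fix k \<alpha> \<beta> assume k: "k \<le> h" "k \<le> (A \<alpha> \<^bold>\<and> A \<beta> \<^bold>\<and> oeq \<alpha> \<beta>)"
  have "k \<le> oeq (f \<alpha>) (f \<beta>)"
    using k(2) by (simp add: le_total_fun_cong[OF order_trans[OF k(1) f]])
  then show "k \<le> neq (cells c p (f \<alpha>)) (cells c p (f \<beta>))"
    unfolding neq_def oeq_def by (simp add: le_nle_cells p)
qed

lemma le_nle_refl:
  assumes "h \<le> is_seq \<xi>"
  shows "h \<le> nle \<xi> \<xi>"
  unfolding nle_def
proof (rule le_allI)
  fix m
  from le_is_seq_total[OF assms] show "h \<le> (\<^bold>\<exists>n. rel (\<le>) (\<xi> m) (\<xi> n))"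
    by (rule le_exE) (rule le_exI, auto intro: le_relI)
qed

section \<open>Left endpoints as an almost rational number\<close>

abbreviation endpoints :: "rat \<Rightarrow> rat \<Rightarrow> 'h::heyting_frame oseq \<Rightarrow> 'h oseq"
  where "endpoints c p a \<equiv> (\<lambda>n. lift (\<lambda>x. c + p * (of_nat (cell c p x) - 1)) (a n))"

lemma le_Qbold_endpoints:
  assumes p: "0 < p" and a: "h \<le> Ro a"
  shows "h \<le> Qbold (endpoints c p a)"
  unfolding Qbold_def
proof (intro le_infI le_allI)
  show "h \<le> is_seq (endpoints c p a)"
    by (intro le_is_seq_lift le_Ro_is_seq a)
  show "h \<le> rel (\<le>) (endpoints c p a n) (endpoints c p a (Suc n))" for n
    using le_Ro_step[OF a]
    by (rule le_rel_lift) (simp add: p cell_mono)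
  from a show "h \<le> (\<^bold>\<exists>F. tv (finite F) \<^bold>\<and> (\<^bold>\<forall>n. \<^bold>\<exists>x. tv (x \<in> F) \<^bold>\<and> endpoints c p a n x))"
  proof (rule le_Ro_boundedE)
    fix k M assume k: "k \<le> h" and M: "\<And>n. k \<le> rel (<) (a n) (std M)"
    \<comment> \<open>All terms are below \<open>M\<close>, so only the cells numbered 0 to
      \<open>cell c p M\<close> occur, and each contributes one endpoint.\<close>
    let ?F = "(\<lambda>i. c + p * (of_nat i - 1)) ` {..cell c p M}"
    have "k \<le> (\<^bold>\<exists>x. tv (x \<in> ?F) \<^bold>\<and> endpoints c p a n x)" for n
      using M[of n]
    proof (rule le_rel_stdE)
      fix l x assume l: "l \<le> k" "l \<le> a n x" "x < M"
      have "cell c p x \<le> cell c p M"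
        using l p by (simp add: cell_mono)
      then show "l \<le> (\<^bold>\<exists>x. tv (x \<in> ?F) \<^bold>\<and> endpoints c p a n x)"
        by (intro le_exI[where x = "c + p * (of_nat (cell c p x) - 1)"] le_infI le_tvI
            le_liftI[where x = x]) (auto simp: l)
    qed
    then show "k \<le> (\<^bold>\<exists>F. tv (finite F) \<^bold>\<and> (\<^bold>\<forall>n. \<^bold>\<exists>x. tv (x \<in> F) \<^bold>\<and> endpoints c p a n x))"
      by (intro le_exI[where x = ?F] le_infI le_allI le_tvI) auto
  qed
qed

text \<open>
  The hypothesis on the first term keeps all terms of \<open>a\<close> out of cell \<open>0\<close>, which is unbounded below.
\<close>

lemma le_zhat_endpoints_ole:
  assumes p: "0 < p" and a: "h \<le> Ro a" and a0: "h \<le> a 0 (c + p)"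
    and ab: "h \<le> nle (cells c p a) (cells c p b)"
  shows "h \<le> ole (zhat (endpoints c p a)) b"
  unfolding ole_def
proof (rule le_allI)
  fix m
  from ab have "h \<le> (\<^bold>\<exists>n. rel (\<le>) (cells c p a m) (cells c p b n))"
    unfolding nle_def by (rule le_allD)
  then show "h \<le> (\<^bold>\<exists>n. rel (<) (zhat (endpoints c p a) m) (b n))"
  proof (rule le_exE)
    fix k n assume k: "k \<le> h" "k \<le> rel (\<le>) (cells c p a m) (cells c p b n)"
    from k(2) have "k \<le> rel (<) (zhat (endpoints c p a) m) (b n)"
    proof (rule le_relE)
      fix k' i j assume k': "k' \<le> k" "k' \<le> cells c p a m i" "k' \<le> cells c p b n j" "i \<le> j"
      from k'(2) show "k' \<le> rel (<) (zhat (endpoints c p a) m) (b n)"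
      proof (rule le_liftE)
        fix l x assume l: "l \<le> k'" "l \<le> a m x" "i = cell c p x"
        from l(1) k'(3) have "l \<le> cells c p b n j" by (rule order_trans)
        then show "l \<le> rel (<) (zhat (endpoints c p a) m) (b n)"
        proof (rule le_liftE)
          fix q y assume q: "q \<le> l" "q \<le> b n y" "j = cell c p y"
          have "q \<le> h" using k(1) k'(1) l(1) q(1) by (auto intro: order_trans)
          then have qa: "q \<le> Ro a" "q \<le> a 0 (c + p)" "q \<le> a m x"
            using a a0 l(2) q(1) by (auto intro: order_trans)
          show "q \<le> rel (<) (zhat (endpoints c p a) m) (b n)"
          proof (rule le_Ro_mono_values[OF qa(1) le0 qa(2,3)])
            assume "c + p \<le> x"
            \<comment> \<open>As \<open>x\<close> is at least the first term \<open>c + p\<close>,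
              it lies beyond cell 0, and so does \<open>y\<close>, whose cell number is no smaller.
              This makes \<open>cell_less\<close> applicable to \<open>y\<close>.\<close>
            then have "0 < i"
              using p l(3) by (intro cell_pos[THEN ord_less_eq_trans]) auto
            have "c + p * (of_nat i - 1) \<le> c + p * (of_nat j - 1)"
              using p \<open>i \<le> j\<close> by simp
            also have "\<dots> < y"
              using cell_less[of p c y] p \<open>0 < i\<close> \<open>i \<le> j\<close> q(3) by simp
            finally have "c + p * (of_nat i - 1) < y" .
            \<comment> \<open>The shift in \<open>zhat\<close> lowers the endpoint further, so it
              helps here; in the upper bound it has to be compensated.\<close>
            moreover have "(0::rat) < 1 / (of_nat m + 1)"
              by (simp add: add_nonneg_pos)
            ultimately have "c + p * (of_nat i - 1) - 1 / (of_nat m + 1) < y"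
              by linarith
            moreover have "q \<le> zhat (endpoints c p a) m
                (c + p * (of_nat i - 1) - 1 / (of_nat m + 1))"
              unfolding zhat_def
              by (rule le_liftI[where x = "c + p * (of_nat i - 1)"],
                  rule le_liftI[where x = x]) (simp_all add: qa l(3))
            ultimately show "q \<le> rel (<) (zhat (endpoints c p a) m) (b n)"
              using q(2) by (intro le_relI)
          qed
        qed
      qed
    qed
    then show "k \<le> (\<^bold>\<exists>n. rel (<) (zhat (endpoints c p a) m) (b n))"
      by (rule le_exI)
  qed
qed

lemma ex_reciprocal_less:
  assumes "(0::rat) < e"
  shows "\<exists>N\<ge>n. 1 / (of_nat N + 1) < e"
proof -
  obtain k :: nat where k: "1 / e < of_nat k"
    using reals_Archimedean2 by blast
  have "1 / e < of_nat (max n k) + 1"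
    using k by (simp add: of_nat_max)
  then have "1 / (of_nat (max n k) + 1) < e"
    using assms by (simp add: field_simps add_nonneg_pos)
  then show ?thesis
    by (intro exI[of _ "max n k"]) simp
qed

text \<open>A term \<open>y\<close> of \<open>b\<close> lies strictly below its successor
  \<open>y'\<close>, which is at most the right endpoint of its cell, that is, the left endpoint
  plus \<open>p\<close>. The gap \<open>y' - y\<close> absorbs the shift in \<open>zhat\<close>.
  Cell 0 is harmless here, since only upper bounds of cells are used.\<close>

lemma le_ole_zhat_endpoints:
  assumes p: "0 < p" and a: "h \<le> Ro a" and b: "h \<le> Ro b"
    and ba: "h \<le> nle (cells c p b) (cells c p a)"
  shows "h \<le> ole b (oplus (zhat (endpoints c p a)) p)" (is "_ \<le> ole b ?z")
  unfolding ole_def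
proof (rule le_allI)
  fix m
  let ?G = "\<^bold>\<exists>n. rel (<) (b m) (?z n)"
  from ba have "h \<le> (\<^bold>\<exists>n. rel (\<le>) (cells c p b (Suc m)) (cells c p a n))"
    unfolding nle_def by (rule le_allD)
  then show "h \<le> ?G"
  proof (rule le_exE)
    fix k n assume k: "k \<le> h" "k \<le> rel (\<le>) (cells c p b (Suc m)) (cells c p a n)"
    have "k \<le> rel (<) (b m) (b (Suc m))"
      using order_trans[OF k(1) b] by (rule le_Ro_step)
    then show "k \<le> ?G"
    proof (rule le_relE)
      fix k1 y y' assume k1: "k1 \<le> k" "k1 \<le> b m y" "k1 \<le> b (Suc m) y'" "y < y'"
      \<comment> \<open>\<open>N\<close> is so large that the shift stays below the gap, and at
        least \<open>n\<close>, so that the cell number of \<open>a N\<close> is no smaller than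
        that of \<open>a n\<close>.\<close>
      then obtain N where N: "n \<le> N" "1 / (of_nat N + 1) < y' - y"
        using ex_reciprocal_less[of "y' - y" n] by auto
      have h1: "k1 \<le> h" using k1(1) k(1) by (rule order_trans)
      have "k1 \<le> (\<^bold>\<exists>x. a N x)"
        using order_trans[OF h1 a] by (intro le_is_seq_total le_Ro_is_seq)
      then have "k1 \<le> rel (<) (b m) (?z N)"
      proof (rule le_exE)
        fix k2 x' assume k2: "k2 \<le> k1" "k2 \<le> a N x'"
        have "k2 \<le> rel (\<le>) (cells c p b (Suc m)) (cells c p a n)"
          using k2(1) k1(1) k(2) by (auto intro: order_trans)
        then show "k2 \<le> rel (<) (b m) (?z N)"
        proof (rule le_relE)
          fix k3 j i
          assume k3: "k3 \<le> k2" "k3 \<le> cells c p b (Suc m) j" "k3 \<le> cells c p a n i" "j \<le> i"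
          from k3(2) show "k3 \<le> rel (<) (b m) (?z N)"
          proof (rule le_liftE)
            fix k4 y'' assume k4: "k4 \<le> k3" "k4 \<le> b (Suc m) y''" "j = cell c p y''"
            from k4(1) k3(3) have "k4 \<le> cells c p a n i" by (rule order_trans)
            then show "k4 \<le> rel (<) (b m) (?z N)"
            proof (rule le_liftE)
              fix q x assume q: "q \<le> k4" "q \<le> a n x" "i = cell c p x"
              have q2: "q \<le> k2" using q(1) k4(1) k3(1) by (auto intro: order_trans)
              then have q1: "q \<le> k1" using k2(1) by (auto intro: order_trans)
              have qh: "q \<le> Ro a" "q \<le> Ro b"
                using order_trans[OF q1 h1] a b by (auto intro: order_trans)
              have qv: "q \<le> b m y" "q \<le> b (Suc m) y'" "q \<le> b (Suc m) y''" "q \<le> a N x'"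
                using q1 q2 q(1) k1 k2 k4 by (auto intro: order_trans)
              show "q \<le> rel (<) (b m) (?z N)"
              \<comment> \<open>\<open>y'\<close> came from the comparison with \<open>y\<close>,
                \<open>y''\<close> from the comparison of cells; both are values of
                \<open>b (Suc m)\<close>.\<close>
              proof (rule le_is_seq_unique[OF le_Ro_is_seq[OF qh(2)] qv(2,3)],
                  rule le_Ro_mono_values[OF qh(1) N(1) q(2) qv(4)])
                assume "y' = y''" "x \<le> x'"
                have "y' \<le> c + p * of_nat j"
                  using le_cell[OF p] k4(3) \<open>y' = y''\<close> by simp
                also have "\<dots> \<le> c + p * of_nat (cell c p x')"
                  using p \<open>j \<le> i\<close> cell_mono[OF p \<open>x \<le> x'\<close>, of c] q(3) by simp
                finally have "y < c + p * (of_nat (cell c p x') - 1) - 1 / (of_nat N + 1) + p"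
                  using N(2) by (simp add: algebra_simps)
                moreover have "q \<le> ?z N
                    (c + p * (of_nat (cell c p x') - 1) - 1 / (of_nat N + 1) + p)"
                  unfolding oplus_def zhat_def
                  by (rule le_liftI, rule le_liftI, rule le_liftI, rule qv(4)) (rule refl)+
                ultimately show "q \<le> rel (<) (b m) (?z N)"
                  using qv(1) by (intro le_relI)
              qed
            qed
          qed
        qed
      qed
      then show "k1 \<le> ?G" by (rule le_exI)
    qed
  qed
qed

text \<open>The almost rational number is built from \<open>a\<close> alone. The first term of
  \<open>b\<close> is not restricted, so early terms of \<open>b\<close> may lie in cell 0.\<close>

lemma le_dd_of_neq_cells:
  assumes p: "0 < p" and a: "h \<le> Ro a" and b: "h \<le> Ro b" and a0: "h \<le> a 0 (c + p)"
    and ab: "h \<le> neq (cells c p a) (cells c p b)"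
  shows "h \<le> dd a b p"
proof -
  \<comment> \<open>The bounds on \<open>a\<close> itself are the case of the two preceding bounds
    where \<open>b\<close> is \<open>a\<close>.\<close>
  have aa: "h \<le> nle (cells c p a) (cells c p a)"
    by (rule le_nle_refl[OF le_is_seq_lift[OF le_Ro_is_seq[OF a]]])
  have "h \<le> nle (cells c p a) (cells c p b)" "h \<le> nle (cells c p b) (cells c p a)"
    using ab by (simp_all add: neq_def)
  with aa show ?thesis
    unfolding dd_def
    by (intro le_exI[where x = "endpoints c p a"] le_exI[where x = p] le_infI le_tvI
        le_Qbold_endpoints le_zhat_endpoints_ole le_ole_zhat_endpoints a b a0 p conjI order_refl)
qed


section \<open>Continuity\<close>

text \<open>Equal arguments stay in \<open>I01\<close> and have equal values under \<open>f\<close>,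
  and \<open>V\<close> is closed under equality.\<close>

lemma le_oset_preimage:
  assumes f: "h \<le> total_fun I01 Ro oeq f" and V: "h \<le> oset V"
  shows "h \<le> oset (preimage f V)"
  unfolding oset_def subset_of_def
proof (intro le_infI le_allI le_himpI)
  show "k \<le> Ro \<alpha>" if "k \<le> preimage f V \<alpha>" for k \<alpha>
    using that by (simp add: preimage_def I01_def)
next
  fix k \<alpha> \<beta> assume k: "k \<le> h" "k \<le> (preimage f V \<alpha> \<^bold>\<and> Ro \<beta> \<^bold>\<and> oeq \<alpha> \<beta>)"
  then have k2: "k \<le> I01 \<alpha>" "k \<le> V (f \<alpha>)" "k \<le> Ro \<beta>" "k \<le> oeq \<alpha> \<beta>"
    by (simp_all add: preimage_def)
  from k2(1,3,4) have \<beta>: "k \<le> I01 \<beta>"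
    by (rule le_I01_oeq)
  have kf: "k \<le> total_fun I01 Ro oeq f"
    using k(1) f by (rule order_trans)
  have "k \<le> oset V"
    using k(1) V by (rule order_trans)
  then have "k \<le> (\<^bold>\<forall>\<alpha>. \<^bold>\<forall>\<beta>. V \<alpha> \<^bold>\<and> Ro \<beta> \<^bold>\<and> oeq \<alpha> \<beta> \<^bold>\<longrightarrow> V \<beta>)"
    by (simp add: oset_def)
  then have "k \<le> (V (f \<alpha>) \<^bold>\<and> Ro (f \<beta>) \<^bold>\<and> oeq (f \<alpha>) (f \<beta>) \<^bold>\<longrightarrow> V (f \<beta>))"
    by (simp add: le_INF_iff)
  then have "k \<le> V (f \<beta>)"
    by (rule le_himpD) (simp add: k2 \<beta> le_total_funD[OF kf] le_total_fun_cong[OF kf])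
  with \<beta> show "k \<le> preimage f V \<beta>"
    by (simp add: preimage_def)
qed

text \<open>OCP, \<open>f\<close> and \<open>V\<close> enter the theorem under nested implications,
  so an arbitrary stage \<open>h\<close> is considered.\<close>

lemma le_T1_preimage:
  fixes f :: "'h::heyting_frame oseq \<Rightarrow> 'h oseq"
  assumes ocp: "h \<le> (OCP :: 'h)" and f: "h \<le> total_fun I01 Ro oeq f" and V: "h \<le> T2 V"
  shows "h \<le> T1 (preimage f V)"
  unfolding T1_def
proof (intro le_infI le_allI)
  show "h \<le> oset (preimage f V)"
    using V by (intro le_oset_preimage f) (simp add: T2_def)
  show "h \<le> subset_of (preimage f V) I01"
    unfolding subset_of_def preimage_def by (intro le_allI le_himpI) simp
next
  fix \<alpha> :: "'h oseq"
  let ?G = "\<^bold>\<exists>E. noninf_C01 E \<^bold>\<and> subset_of (S E \<alpha>) (preimage f V)"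
  show "h \<le> (preimage f V \<alpha> \<^bold>\<longrightarrow> ?G)"
  proof (rule le_himpI)
    fix k assume k: "k \<le> h" "k \<le> preimage f V \<alpha>"
    then have \<alpha>: "k \<le> I01 \<alpha>" "k \<le> V (f \<alpha>)"
      by (simp_all add: preimage_def)
    have "k \<le> T2 V"
      using k(1) V by (rule order_trans)
    then have "k \<le> (\<^bold>\<forall>x. V x \<^bold>\<longrightarrow> (\<^bold>\<exists>p. tv (0 < p) \<^bold>\<and> subset_of (\<lambda>y. Ro y \<^bold>\<and> dd x y p) V))"
      by (simp add: T2_def)
    from le_himpD[OF le_allD[OF this] \<alpha>(2)] show "k \<le> ?G"
    proof (rule le_exE)
      fix k1 p assume k1: "k1 \<le> k"
        "k1 \<le> (tv (0 < p) \<^bold>\<and> subset_of (\<lambda>y. Ro y \<^bold>\<and> dd (f \<alpha>) y p) V)"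
      then have "k1 \<le> tv (0 < p)" and W: "k1 \<le> subset_of (\<lambda>y. Ro y \<^bold>\<and> dd (f \<alpha>) y p) V"
        by simp_all
      from this(1) show "k1 \<le> ?G"
      proof (rule le_tvE)
        assume p: "0 < p"
        have "k1 \<le> h"
          using k1(1) k(1) by (rule order_trans)
        then have f1: "k1 \<le> total_fun I01 Ro oeq f" and ocp1: "k1 \<le> OCP"
          using f ocp by (auto intro: order_trans)
        have \<alpha>1: "k1 \<le> I01 \<alpha>"
          using k1(1) \<alpha>(1) by (rule order_trans)
        have R1: "k1 \<le> Ro (f \<alpha>)"
          by (rule le_total_funD[OF f1 \<alpha>1])
        \<comment> \<open>The grid of cells needs a rational offset, but the first term of
          \<open>f \<alpha>\<close> is an internal term; its value is fixed by passing to a smaller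
          stage.\<close>
        have "k1 \<le> (\<^bold>\<exists>x. f \<alpha> 0 x)"
          by (rule le_is_seq_total[OF le_Ro_is_seq[OF R1]])
        then show "k1 \<le> ?G"
        proof (rule le_exE)
          fix k2 x assume k2: "k2 \<le> k1" "k2 \<le> f \<alpha> 0 x"
          \<comment> \<open>With this offset the first term of \<open>f \<alpha>\<close> is the
            right endpoint of cell 1, so no term of \<open>f \<alpha>\<close> falls into cell
            0.\<close>
          define c where "c = x - p"
          let ?\<Phi> = "\<lambda>\<beta>. cells c p (f \<beta>)"
          have x: "k2 \<le> f \<alpha> 0 (c + p)"
            using k2(2) by (simp add: c_def)
          have \<Phi>: "k2 \<le> total_fun I01 Nstar neq ?\<Phi>"
            using k2(1) f1 by (intro le_total_fun_cells p) (rule order_trans)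
          have "k2 \<le> OCP"
            using k2(1) ocp1 by (rule order_trans)
          \<comment> \<open>The set \<open>E\<close> depends on \<open>p\<close> and
            \<open>c\<close>, hence on \<open>\<alpha>\<close>, as the definition of open sets in
            \<open>T1\<close> allows.\<close>
          from le_himpD[OF le_allD[OF this[unfolded OCP_def]] \<Phi>] show "k2 \<le> ?G"
          proof (rule le_exE)
            fix k3 E assume k3: "k3 \<le> k2" "k3 \<le> (noninf_C01 E \<^bold>\<and>
              (\<^bold>\<forall>\<alpha>. \<^bold>\<forall>\<beta>. I01 \<alpha> \<^bold>\<and> I01 \<beta> \<^bold>\<longrightarrow> same_trace E \<alpha> \<beta> \<^bold>\<longrightarrow> neq (?\<Phi> \<alpha>) (?\<Phi> \<beta>)))"
            have "k3 \<le> subset_of (S E \<alpha>) (preimage f V)"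
              unfolding subset_of_def
            proof (intro le_allI le_himpI)
              fix q \<beta> assume q: "q \<le> k3" "q \<le> S E \<alpha> \<beta>"
              then have \<beta>: "q \<le> I01 \<beta>" "q \<le> same_trace E \<alpha> \<beta>"
                by (simp_all add: S_def)
              have q2: "q \<le> k2" using q(1) k3(1) by (rule order_trans)
              then have q1: "q \<le> k1" using k2(1) by (rule order_trans)
              have q\<alpha>: "q \<le> I01 \<alpha>" "q \<le> Ro (f \<alpha>)" "q \<le> f \<alpha> 0 (c + p)"
                and qf: "q \<le> total_fun I01 Ro oeq f"
                and qW: "q \<le> subset_of (\<lambda>y. Ro y \<^bold>\<and> dd (f \<alpha>) y p) V"
                using q1 q2 \<alpha>1 R1 x f1 W by (auto intro: order_trans)
              have "q \<le> (\<^bold>\<forall>\<alpha>. \<^bold>\<forall>\<beta>. I01 \<alpha> \<^bold>\<and> I01 \<beta> \<^bold>\<longrightarrow>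
                  same_trace E \<alpha> \<beta> \<^bold>\<longrightarrow> neq (?\<Phi> \<alpha>) (?\<Phi> \<beta>))"
                using order_trans[OF q(1) k3(2)] by simp
              then have "q \<le> (I01 \<alpha> \<^bold>\<and> I01 \<beta> \<^bold>\<longrightarrow>
                  same_trace E \<alpha> \<beta> \<^bold>\<longrightarrow> neq (?\<Phi> \<alpha>) (?\<Phi> \<beta>))"
                by (simp add: le_INF_iff)
              from le_himpD[OF le_himpD[OF this]] have "q \<le> neq (?\<Phi> \<alpha>) (?\<Phi> \<beta>)"
                using q\<alpha>(1) \<beta> by simp
              \<comment> \<open>Equal cell numbers put \<open>f \<beta>\<close> within distance
                \<open>p\<close> of \<open>f \<alpha>\<close>, and \<open>p\<close> was chosen as a
                radius of \<open>V\<close> at \<open>f \<alpha>\<close>.\<close>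
              then have "q \<le> dd (f \<alpha>) (f \<beta>) p"
                by (rule le_dd_of_neq_cells[OF p q\<alpha>(2) le_total_funD[OF qf \<beta>(1)] q\<alpha>(3)])
              with le_total_funD[OF qf \<beta>(1)] have "q \<le> (Ro (f \<beta>) \<^bold>\<and> dd (f \<alpha>) (f \<beta>) p)"
                by simp
              from le_himpD[OF le_allD[OF qW[unfolded subset_of_def]] this]
              have "q \<le> V (f \<beta>)" .
              with \<beta>(1) show "q \<le> preimage f V \<beta>"
                by (simp add: preimage_def)
            qed
            with k3(2) show "k3 \<le> ?G"
              by (intro le_exI[where x = E]) simp
          qed
        qed
      qed
    qed
  qed
qed

theorem theorem3p9:
  "valid ((OCP :: 'h::heyting_frame) \<^bold>\<longrightarrow>
     (\<^bold>\<forall>f :: 'h oseq \<Rightarrow> 'h oseq. total_fun I01 Ro oeq f \<^bold>\<longrightarrow> continuous_T1_T2 f))"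
proof -
  have "(top :: 'h) \<le> (OCP \<^bold>\<longrightarrow>
     (\<^bold>\<forall>f :: 'h oseq \<Rightarrow> 'h oseq. total_fun I01 Ro oeq f \<^bold>\<longrightarrow> continuous_T1_T2 f))"
    unfolding continuous_T1_T2_def
  proof (intro le_himpI le_allI)
    fix k l m :: 'h and f V
    assume k: "k \<le> OCP" "l \<le> k" "l \<le> total_fun I01 Ro oeq f" "m \<le> l" "m \<le> T2 V"
    show "m \<le> T1 (preimage f V)"
      by (rule le_T1_preimage[OF order_trans[OF k(4) order_trans[OF k(2,1)]]
            order_trans[OF k(4,3)] k(5)])
  qed
  then show ?thesis
    by (simp add: valid_def top_unique)
qed

end
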